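(* The following equalities hold: $f(3)=7$, $f(4)=11$, $f(5)=14$, $f(6)=18$, $f(7)=21$, $f(8)=25$, $f(9)=28$, $f(10)=32$, $f(11)=35$, $f(12)=39$.
   Context: All graphs are finite and simple; a graph is nonempty if it has at least one edge. A numbering of a graph $G$ of order $n$ is a bijection $g:V(G)\to\{1,\dots,n\}$. For a nonempty graph $G$, $\mathrm{str}_g(G)=\max\{g(u)+g(v) : uv\in E(G)\}$, and the strength of $G$ is $\mathrm{str}(G)=\min\{\mathrm{str}_g(G) : g \text{ is a numbering of } G\}$. Define $f(n)=\max\{\mathrm{str}(G)+\mathrm{str}(\overline{G})\}$, where the maximum is over all graphs $G$ of order $n$ such that both $G$ and its complement $\overline{G}$ are nonempty. *)

theory Defs
  imports Complex_Main
begin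

text \<open>A graph is given by its vertex set \<open>V\<close> and its edge set \<open>E\<close>, a set of 2-element subsets
  of \<open>V\<close>; its order is \<open>card V\<close>.\<close>

definition simple_graph :: "'a set \<Rightarrow> 'a set set \<Rightarrow> bool" where
  "simple_graph V E \<longleftrightarrow> finite V \<and> (\<forall>e\<in>E. e \<subseteq> V \<and> card e = 2)"

definition complement_edges :: "'a set \<Rightarrow> 'a set set \<Rightarrow> 'a set set" where
  "complement_edges V E = {e. e \<subseteq> V \<and> card e = 2 \<and> e \<notin> E}"

definition numbering :: "'a set \<Rightarrow> ('a \<Rightarrow> nat) \<Rightarrow> bool" where
  "numbering V g \<longleftrightarrow> bij_betw g V {1..card V}"

definition numbering_strength :: "'a set set \<Rightarrow> ('a \<Rightarrow> nat) \<Rightarrow> nat" where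
  "numbering_strength E g = Max {g u + g v | u v. {u, v} \<in> E}"

definition strength :: "'a set \<Rightarrow> 'a set set \<Rightarrow> nat" where
  "strength V E = Min {numbering_strength E g | g. numbering V g}"

text \<open>Vertices are taken to be natural numbers so that the graphs of order \<open>n\<close> form a set in HOL.
  This loses no graph: by \<open>strength_sum_le\<close> below, the maximum also bounds the graphs
  over every other vertex type.\<close>

definition max_strength_sum :: "nat \<Rightarrow> nat" where
  "max_strength_sum n =
     Max {strength V E + strength V (complement_edges V E) | (V :: nat set) E.
            simple_graph V E \<and> card V = n \<and> E \<noteq> {} \<and> complement_edges V E \<noteq> {}}"

lemma simple_graph_complement:
  "simple_graph V E \<Longrightarrow> simple_graph V (complement_edges V E)"
  by (auto simp: simple_graph_def complement_edges_def)

lemma numbering_strength_le: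
  assumes "simple_graph V E" "E \<noteq> {}" "numbering V g"
  shows "numbering_strength E g \<le> 2 * card V"
proof -
  let ?S = "{g u + g v | u v. {u, v} \<in> E}"
  have fin: "finite V" and sub: "\<And>u v. {u, v} \<in> E \<Longrightarrow> u \<in> V \<and> v \<in> V"
    using assms(1) by (auto simp: simple_graph_def)
  have range: "\<And>u. u \<in> V \<Longrightarrow> g u \<le> card V"
    using assms(3) by (auto simp: numbering_def bij_betw_def)
  have bound: "x \<le> 2 * card V" if x: "x \<in> ?S" for x
  proof -
    obtain u v where "x = g u + g v" "{u, v} \<in> E" using x by blast
    with sub range show ?thesis by (metis add_mono mult_2)
  qed
  obtain e where "e \<in> E" using assms(2) by blast
  then have "card e = 2" using assms(1) by (auto simp: simple_graph_def)
  then obtain a b where "e = {a, b}" by (auto simp: card_2_iff)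
  with \<open>e \<in> E\<close> have "?S \<noteq> {}" by blast
  moreover have "finite ?S"
    by (rule finite_subset[of _ "{..2 * card V}"]) (use bound in \<open>meson atMost_iff subsetI\<close>, simp)
  ultimately have "Max ?S \<in> ?S" by (rule Max_in[rotated])
  then show ?thesis unfolding numbering_strength_def by (rule bound)
qed

lemma ex_numbering: "finite V \<Longrightarrow> \<exists>g. numbering V g"
  unfolding numbering_def by (simp add: finite_same_card_bij)

lemma strength_le:
  assumes "simple_graph V E" "E \<noteq> {}"
  shows "strength V E \<le> 2 * card V"
proof -
  let ?S = "{numbering_strength E g | g. numbering V g}"
  have "?S \<subseteq> {..2 * card V}" using numbering_strength_le[OF assms] by auto
  then have "finite ?S" by (rule finite_subset) simp
  moreover obtain g where "numbering V g"
    using ex_numbering[of V] assms(1) unfolding simple_graph_def by blast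
  ultimately have "strength V E \<le> numbering_strength E g"
    unfolding strength_def by (intro Min_le) auto
  with numbering_strength_le[OF assms \<open>numbering V g\<close>] show ?thesis by simp
qed

lemma numbering_strength_image:
  assumes "simple_graph V E"
  shows "numbering_strength ((`) h ` E) g = numbering_strength E (g \<circ> h)"
proof -
  have "{g u + g v | u v. {u, v} \<in> (`) h ` E} = {(g \<circ> h) a + (g \<circ> h) b | a b. {a, b} \<in> E}"
    (is "?L = ?R")
  proof
    show "?L \<subseteq> ?R"
    proof
      fix x assume "x \<in> ?L"
      then obtain u v e where x: "x = g u + g v" and e: "e \<in> E" "{u, v} = h ` e" by blast
      from e(1) assms have "card e = 2" by (auto simp: simple_graph_def)
      then obtain a b where ab: "e = {a, b}" by (auto simp: card_2_iff)
      with e(2) have "{u, v} = {h a, h b}" by simp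
      then have "x = (g \<circ> h) a + (g \<circ> h) b" using x by (auto simp: doubleton_eq_iff)
      with ab e(1) show "x \<in> ?R" by blast
    qed
    show "?R \<subseteq> ?L"
    proof
      fix x assume "x \<in> ?R"
      then obtain a b where x: "x = g (h a) + g (h b)" and ab: "{a, b} \<in> E" by auto
      from imageI[OF ab, of "(`) h"] have "{h a, h b} \<in> (`) h ` E" by simp
      with x show "x \<in> ?L" by blast
    qed
  qed
  then show ?thesis by (simp only: numbering_strength_def)
qed

lemma strength_image:
  assumes "simple_graph V E" "inj_on h V"
  shows "strength (h ` V) ((`) h ` E) = strength V E"
proof -
  have bij: "bij_betw h V (h ` V)" and c: "card (h ` V) = card V"
    using assms(2) by (auto simp: inj_on_imp_bij_betw card_image)
  have "{numbering_strength ((`) h ` E) g | g. numbering (h ` V) g} =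
        {numbering_strength E g | g. numbering V g}" (is "?L = ?R")
  proof
    show "?L \<subseteq> ?R"
    proof
      fix x assume "x \<in> ?L"
      then obtain g where g: "numbering (h ` V) g" and x: "x = numbering_strength ((`) h ` E) g"
        by blast
      from g have "numbering V (g \<circ> h)"
        using bij_betw_trans[OF bij] unfolding numbering_def c by blast
      with x numbering_strength_image[OF assms(1)] show "x \<in> ?R" by blast
    qed
    show "?R \<subseteq> ?L"
    proof
      fix x assume "x \<in> ?R"
      then obtain g where g: "numbering V g" and x: "x = numbering_strength E g" by blast
      let ?g = "g \<circ> inv_into V h"
      have "numbering (h ` V) ?g"
        using g bij_betw_trans[OF bij_betw_inv_into[OF bij]] by (auto simp: numbering_def c)
      moreover have "numbering_strength ((`) h ` E) ?g = x"
      proof -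
        have eq: "(?g \<circ> h) u = g u" if "u \<in> V" for u using that assms(2) by simp
        have sub: "u \<in> V \<and> v \<in> V" if "{u, v} \<in> E" for u v
          using that assms(1) by (auto simp: simple_graph_def)
        have "{(?g \<circ> h) u + (?g \<circ> h) v | u v. {u, v} \<in> E} = {g u + g v | u v. {u, v} \<in> E}"
        proof (intro Collect_cong ex_cong1)
          fix x u v
          show "(x = (?g \<circ> h) u + (?g \<circ> h) v \<and> {u, v} \<in> E) =
              (x = g u + g v \<and> {u, v} \<in> E)"
            using eq[of u] eq[of v] sub[of u v] by auto
        qed
        then show ?thesis
          unfolding numbering_strength_image[OF assms(1)] x by (simp only: numbering_strength_def)
      qed
      ultimately show "x \<in> ?L" by blast
    qed
  qed
  then show ?thesis by (simp only: strength_def)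
qed

lemma simple_graph_image:
  assumes "simple_graph V E" "inj_on h V"
  shows "simple_graph (h ` V) ((`) h ` E)"
  using assms card_image[OF inj_on_subset[OF assms(2)]] by (fastforce simp: simple_graph_def)

lemma complement_edges_image:
  assumes "simple_graph V E" "inj_on h V"
  shows "complement_edges (h ` V) ((`) h ` E) = (`) h ` complement_edges V E"
proof
  show "complement_edges (h ` V) ((`) h ` E) \<subseteq> (`) h ` complement_edges V E"
  proof
    fix e assume e: "e \<in> complement_edges (h ` V) ((`) h ` E)"
    then obtain d where d: "d \<subseteq> V" "e = h ` d"
      by (auto simp: complement_edges_def subset_image_iff)
    with e card_image[OF inj_on_subset[OF assms(2) d(1)]] have "d \<in> complement_edges V E"
      by (auto simp: complement_edges_def)
    with d show "e \<in> (`) h ` complement_edges V E" by blast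
  qed
  show "(`) h ` complement_edges V E \<subseteq> complement_edges (h ` V) ((`) h ` E)"
  proof
    fix e assume "e \<in> (`) h ` complement_edges V E"
    then obtain d where d: "d \<subseteq> V" "card d = 2" "d \<notin> E" "e = h ` d"
      by (auto simp: complement_edges_def)
    have "e \<notin> (`) h ` E"
    proof
      assume "e \<in> (`) h ` E"
      then obtain d' where d': "d' \<in> E" "h ` d = h ` d'" unfolding d(4) by (rule imageE)
      then have "d' \<subseteq> V" using assms(1) by (auto simp: simple_graph_def)
      then have "d = d'" using inj_on_image_eq_iff[OF assms(2) d(1)] d'(2) by blast
      with d' d(3) show False by simp
    qed
    moreover have "e \<subseteq> h ` V" using d by blast
    moreover have "card e = 2" using d card_image[OF inj_on_subset[OF assms(2) d(1)]] by simp
    ultimately show "e \<in> complement_edges (h ` V) ((`) h ` E)"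
      by (simp add: complement_edges_def)
  qed
qed

lemma strength_sum_le:
  fixes V :: "'a set"
  assumes G: "simple_graph V E" and ne: "E \<noteq> {}" "complement_edges V E \<noteq> {}"
  shows "strength V E + strength V (complement_edges V E) \<le> max_strength_sum (card V)"
proof -
  let ?S = "{strength V' E' + strength V' (complement_edges V' E') | (V' :: nat set) E'.
      simple_graph V' E' \<and> card V' = card V \<and> E' \<noteq> {} \<and> complement_edges V' E' \<noteq> {}}"
  obtain h :: "'a \<Rightarrow> nat" where h: "inj_on h V"
    using G finite_imp_inj_to_nat_seg[of V] unfolding simple_graph_def by blast
  note Gc = simple_graph_complement[OF G]
  note c = complement_edges_image[OF G h]
  have "strength V E + strength V (complement_edges V E) =
      strength (h ` V) ((`) h ` E) + strength (h ` V) (complement_edges (h ` V) ((`) h ` E))"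
    by (simp only: c strength_image[OF G h] strength_image[OF Gc h])
  moreover have "simple_graph (h ` V) ((`) h ` E)" "card (h ` V) = card V"
    "(`) h ` E \<noteq> {}" "complement_edges (h ` V) ((`) h ` E) \<noteq> {}"
    using simple_graph_image[OF G h] h ne c by (auto simp: card_image)
  ultimately have mem: "strength V E + strength V (complement_edges V E) \<in> ?S" by blast
  have "x \<le> 4 * card V" if x: "x \<in> ?S" for x
  proof -
    obtain V' :: "nat set" and E'
      where x': "x = strength V' E' + strength V' (complement_edges V' E')"
        and G': "simple_graph V' E'" "E' \<noteq> {}" "complement_edges V' E' \<noteq> {}"
        and cV: "card V' = card V"
      using x by blast
    show ?thesis
      using strength_le[OF G'(1,2)] strength_le[OF simple_graph_complement[OF G'(1)] G'(3)]
      by (simp add: x' cV)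
  qed
  then have "?S \<subseteq> {..4 * card V}" by (meson atMost_iff subsetI)
  then have "finite ?S" by (rule finite_subset) simp
  then show ?thesis unfolding max_strength_sum_def using mem by (rule Max_ge)
qed

end

theory Submission
  imports Defs
begin

text \<open>Write \<open>T k\<close> for the threshold graph on \<open>1, \<dots>, k\<close> in which distinct \<open>i\<close>, \<open>j\<close> are
  adjacent when \<open>i + j \<le> k + 1\<close>. If a numbering of a graph of order \<open>n\<close> is read backwards, label
  sums greater than \<open>2 * n - k\<close> become sums at most \<open>k + 1\<close>; hence the strength is at most
  \<open>2 * n - k\<close> as soon as the complement contains \<open>T k\<close>. This turns the upper bound into a Ramsey
  problem: in the red/blue colouring of the complete graph given by a graph and its complement,
  one looks for a red \<open>T a\<close> and a blue \<open>T b\<close> with \<open>a + b\<close> large, and both colours contain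
  \<open>T 2\<close>, a single edge.

  The common value is \<open>4 * n - \<lceil>n / 2\<rceil> - 3\<close>, so \<open>a + b = \<lceil>n / 2\<rceil> + 3\<close> is wanted
  (\<open>threshold_pair\<close>). If one colour has no \<open>T 3\<close> it is a matching, and the other colour contains
  almost everything (\<open>matching_complement_threshold\<close>). Otherwise both colours contain \<open>T 3\<close>, the
  path with two edges, and what remains is that any 7, 9 or 11 vertices without a red \<open>T 4\<close>, a
  triangle with a pendant edge, contain a blue \<open>T 4\<close>, \<open>T 5\<close> or \<open>T 6\<close> respectively, and that 10
  vertices contain a \<open>T 5\<close> in one of the colours. These bounds are proved by looking at the
  neighbourhood of a vertex, because \<open>T k\<close> consists of a vertex of degree \<open>k - 1\<close> with a copy of
  \<open>T (k - 2)\<close> among its neighbours.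

  The bound is attained by the balanced complete bipartite graph: its strength is at least \<open>n\<close>
  plus its minimum degree \<open>\<lfloor>n / 2\<rfloor>\<close>, and in its complement, a union of two cliques, two of the
  three largest labels fall into the same clique.\<close>

section \<open>Threshold graphs inside a graph\<close>

definition nbrs :: "('a \<Rightarrow> 'a \<Rightarrow> bool) \<Rightarrow> 'a set \<Rightarrow> 'a \<Rightarrow> 'a set" where
  "nbrs R S v = {u \<in> S. R v u}"

text \<open>This is containment of \<open>T k\<close>. Deleting the dominating vertex of \<open>T k\<close> and then the
  isolated vertex that arises leaves \<open>T (k - 2)\<close>, so instead of an embedding the recursion asks
  for a vertex of degree at least \<open>k - 1\<close> whose neighbourhood contains \<open>T (k - 2)\<close>.\<close>

fun has_threshold :: "('a \<Rightarrow> 'a \<Rightarrow> bool) \<Rightarrow> 'a set \<Rightarrow> nat \<Rightarrow> bool" where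
  "has_threshold R S 0 = True"
| "has_threshold R S (Suc 0) = True"
| "has_threshold R S (Suc (Suc k)) =
    (\<exists>v\<in>S. k < card (nbrs R S v) \<and> has_threshold R (nbrs R S v) k)"

lemma nbrs_subset: "nbrs R S v \<subseteq> S"
  by (auto simp: nbrs_def)

lemma finite_nbrs: "finite S \<Longrightarrow> finite (nbrs R S v)"
  by (simp add: nbrs_def)

lemma nbrs_mono: "S \<subseteq> S' \<Longrightarrow> nbrs R S v \<subseteq> nbrs R S' v"
  by (auto simp: nbrs_def)

lemma has_threshold_mono:
  assumes "has_threshold R S k" "j \<le> k" "S \<subseteq> S'" "finite S'"
  shows "has_threshold R S' j"
  using assms
proof (induction R S k arbitrary: j S' rule: has_threshold.induct)
  case (3 R S k)
  then obtain v where v: "v \<in> S" "k < card (nbrs R S v)" "has_threshold R (nbrs R S v) k"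
    by auto
  show ?case
  proof (cases "j < 2")
    case True
    then have "j = 0 \<or> j = Suc 0" by auto
    then show ?thesis by auto
  next
    case False
    define i where "i = j - 2"
    have j: "j = Suc (Suc i)" "i \<le> k" using False 3(3) by (auto simp: i_def)
    have "card (nbrs R S v) \<le> card (nbrs R S' v)"
      using 3(4,5) by (intro card_mono finite_nbrs nbrs_mono)
    moreover have "has_threshold R (nbrs R S' v) i"
      using 3(1)[OF v(1,3) j(2) nbrs_mono[OF 3(4)] finite_nbrs[OF 3(5)]] .
    ultimately show ?thesis using v(1,2) j 3(4) by (auto intro!: bexI[of _ v])
  qed
qed (auto simp: le_Suc_eq)

lemma has_threshold_intro:
  assumes "v \<in> S" "k \<le> Suc (card (nbrs R S v))" "has_threshold R (nbrs R S v) (k - 2)"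
  shows "has_threshold R S k"
proof (cases "k < 2")
  case True
  then have "k = 0 \<or> k = Suc 0" by auto
  then show ?thesis by auto
next
  case False
  then have "k = Suc (Suc (k - 2))" by simp
  moreover have "has_threshold R S (Suc (Suc (k - 2)))"
    using assms False by (auto intro!: bexI[of _ v])
  ultimately show ?thesis by simp
qed

lemma has_threshold_2:
  assumes "finite S"
  shows "has_threshold R S 2 \<longleftrightarrow> (\<exists>u\<in>S. \<exists>v\<in>S. R u v)"
  using assms by (auto simp: numeral_2_eq_2 card_gt_0_iff finite_nbrs) (auto simp: nbrs_def)

lemma has_threshold_3: "has_threshold R S 3 \<longleftrightarrow> (\<exists>v\<in>S. 2 \<le> card (nbrs R S v))"
  by (simp add: numeral_3_eq_3 Suc_le_eq numeral_2_eq_2)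

lemma clique_has_threshold:
  assumes "finite S" "k \<le> card S" "\<And>u v. u \<in> S \<Longrightarrow> v \<in> S \<Longrightarrow> u \<noteq> v \<Longrightarrow> R u v"
  shows "has_threshold R S k"
  using assms
proof (induction R S k rule: has_threshold.induct)
  case (3 R S k)
  from 3(3) have "S \<noteq> {}" by auto
  then obtain v where v: "v \<in> S" by blast
  have sub: "S - {v} \<subseteq> nbrs R S v" using 3(4) v by (auto simp: nbrs_def)
  have "card (S - {v}) \<le> card (nbrs R S v)" using 3(2) sub by (intro card_mono finite_nbrs)
  then have c: "k < card (nbrs R S v)" using 3(3) v 3(2) by simp
  have "has_threshold R (nbrs R S v) k"
    using 3(4) c by (intro 3(1)[OF v finite_nbrs[OF 3(2)]]) (auto simp: nbrs_def)
  then show ?case using v c by auto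
qed simp_all

section \<open>From threshold graphs to numberings\<close>

text \<open>Unfolds the recursion into an embedding: put the dominating vertex first, then its
  neighbours in the order supplied recursively, then everything else. Positions start at 0, so
  the condition \<open>i + j \<le> k + 1\<close> on \<open>T k\<close> reads \<open>i + j < k\<close>; moving the neighbours back by one
  place raises both positions by 1 and hence matches the step from \<open>k - 2\<close> to \<open>k\<close>.\<close>

lemma threshold_enumeration:
  assumes "has_threshold R S k" "finite S" "\<And>v. \<not> R v v"
  shows "\<exists>xs. distinct xs \<and> set xs = S \<and>
    (\<forall>i j. i < j \<longrightarrow> j < length xs \<longrightarrow> i + j < k \<longrightarrow> R (xs ! i) (xs ! j))"
  using assms
proof (induction R S k rule: has_threshold.induct)
  case (3 R S k)
  then obtain v where v: "v \<in> S" "k < card (nbrs R S v)" "has_threshold R (nbrs R S v) k"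
    by auto
  let ?N = "nbrs R S v"
  obtain ys where ys: "distinct ys" "set ys = ?N"
    "\<And>i j. i < j \<Longrightarrow> j < length ys \<Longrightarrow> i + j < k \<Longrightarrow> R (ys ! i) (ys ! j)"
    using 3(1)[OF v(1,3) finite_nbrs[OF 3(3)] 3(4)] by blast
  obtain zs where zs: "distinct zs" "set zs = S - ?N - {v}"
    using finite_distinct_list[of "S - ?N - {v}"] 3(3) by auto
  have len: "k < length ys" using v(2) ys(1,2) distinct_card by metis
  have "v \<notin> ?N" using 3(4) by (auto simp: nbrs_def)
  then have "distinct (v # ys @ zs)" "set (v # ys @ zs) = S"
    using ys(1,2) zs v(1) nbrs_subset[of R S v] by auto
  moreover have "R ((v # ys @ zs) ! i) ((v # ys @ zs) ! j)"
    if ij: "i < j" "i + j < Suc (Suc k)" for i j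
  proof -
    have j: "j = Suc (j - 1)" "j - 1 < length ys" using ij len by auto
    then have xj: "(v # ys @ zs) ! j = ys ! (j - 1)" using ij by (simp add: nth_append)
    show ?thesis
    proof (cases i)
      case 0
      have "ys ! (j - 1) \<in> ?N" using j(2) ys(2) nth_mem by blast
      then show ?thesis using 0 xj by (simp add: nbrs_def)
    next
      case (Suc i')
      then have "R (ys ! i') (ys ! (j - 1))" using ij j by (intro ys(3)) auto
      moreover have "i' < length ys" using Suc ij j by linarith
      then have "(v # ys @ zs) ! i = ys ! i'" using Suc by (simp add: nth_append)
      ultimately show ?thesis using xj by simp
    qed
  qed
  ultimately show ?case by (intro exI[of _ "v # ys @ zs"] conjI allI impI)
next
  case (1 R S)
  then show ?case using finite_distinct_list[of S] by auto
next
  case (2 R S)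
  then show ?case using finite_distinct_list[of S] by auto
qed

lemma finite_numbering_strengths:
  assumes "simple_graph V E" "E \<noteq> {}"
  shows "finite {numbering_strength E g | g. numbering V g}"
  by (rule finite_subset[of _ "{..2 * card V}"]) (use numbering_strength_le[OF assms] in auto)

text \<open>The numbering runs backwards along the enumeration, giving label \<open>n - i\<close> to position \<open>i\<close>:
  a label sum above \<open>2 * n - k\<close> then means positions with \<open>i + j < k\<close>, which are not joined by an
  edge.\<close>

lemma strength_le_threshold:
  assumes G: "simple_graph V E" "E \<noteq> {}"
    and thr: "has_threshold R V k"
    and R: "\<And>v. \<not> R v v" "\<And>u v. R u v \<Longrightarrow> {u, v} \<notin> E"
  shows "strength V E \<le> 2 * card V - k"
proof -
  have fin: "finite V" using G by (simp add: simple_graph_def)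
  obtain xs where xs: "distinct xs" "set xs = V"
    "\<And>i j. i < j \<Longrightarrow> j < length xs \<Longrightarrow> i + j < k \<Longrightarrow> R (xs ! i) (xs ! j)"
    using threshold_enumeration[OF thr fin R(1)] by blast
  define n where "n = card V"
  have len: "length xs = n" using xs distinct_card n_def by metis
  have bx: "bij_betw (\<lambda>i. xs ! i) {..<n} V"
    using bij_betw_nth[OF xs(1)] len xs(2) by auto
  define p where "p = inv_into {..<n} (\<lambda>i. xs ! i)"
  have bp: "bij_betw p V {..<n}" unfolding p_def by (rule bij_betw_inv_into[OF bx])
  have p: "p u < n" "xs ! p u = u" if "u \<in> V" for u
    using that bp bij_betw_inv_into_right[OF bx] by (auto simp: bij_betw_def p_def)
  define g where "g = (\<lambda>u. n - p u)"
  have "bij_betw (\<lambda>i. n - i) {..<n} {1..n}"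
    by (rule bij_betw_byWitness[where f' = "\<lambda>i. n - i"]) auto
  from bij_betw_trans[OF bp this] have g: "numbering V g"
    by (simp add: numbering_def g_def n_def o_def)
  have le: "g u + g v \<le> 2 * n - k" if uv: "{u, v} \<in> E" for u v
  proof -
    have V: "u \<in> V" "v \<in> V" and "card {u, v} = 2" using G(1) uv by (auto simp: simple_graph_def)
    then have "u \<noteq> v" by auto
    then have "p u \<noteq> p v" using p V by metis
    moreover have "\<not> R u v" "\<not> R v u" using R(2) uv by (metis insert_commute)+
    ultimately have "k \<le> p u + p v"
      using xs(3)[of "p u" "p v"] xs(3)[of "p v" "p u"] p V len by (metis add.commute not_less nat_neq_iff)
    then show ?thesis using p(1)[OF V(1)] p(1)[OF V(2)] by (simp add: g_def)
  qed
  let ?S = "{g u + g v | u v. {u, v} \<in> E}"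
  have sub: "?S \<subseteq> {..2 * n - k}" using le by auto
  then have "finite ?S" by (rule finite_subset) simp
  moreover obtain e where "e \<in> E" using G(2) by blast
  moreover from this obtain a b where "e = {a, b}"
    using G(1) by (auto simp: simple_graph_def card_2_iff)
  ultimately have "numbering_strength E g \<le> 2 * n - k"
    unfolding numbering_strength_def using sub by (intro Max.boundedI) auto
  moreover have "strength V E \<le> numbering_strength E g"
    unfolding strength_def using finite_numbering_strengths[OF G] g by (intro Min_le) auto
  ultimately show ?thesis by (simp add: n_def)
qed

section \<open>Ramsey bounds for threshold graphs\<close>

definition colouring :: "'a set \<Rightarrow> ('a \<Rightarrow> 'a \<Rightarrow> bool) \<Rightarrow> ('a \<Rightarrow> 'a \<Rightarrow> bool) \<Rightarrow> bool" where
  "colouring S R B \<longleftrightarrow> finite S \<and> symp R \<and> symp B \<and> irreflp R \<and> irreflp B \<and>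
    (\<forall>u\<in>S. \<forall>v\<in>S. u \<noteq> v \<longrightarrow> R u v \<or> B u v)"

lemma colouring_finite: "colouring S R B \<Longrightarrow> finite S"
  by (simp add: colouring_def)

lemma colouring_swap: "colouring S R B \<Longrightarrow> colouring S B R"
  by (auto simp: colouring_def)

lemma colouring_subset: "colouring S R B \<Longrightarrow> S' \<subseteq> S \<Longrightarrow> colouring S' R B"
  by (auto simp: colouring_def intro: finite_subset)

lemma colouring_nbrs: "colouring S R B \<Longrightarrow> colouring (nbrs Q S v) R B"
  by (erule colouring_subset) (rule nbrs_subset)

lemma degree_sum:
  assumes "colouring S R B" "v \<in> S"
  shows "card S \<le> Suc (card (nbrs R S v) + card (nbrs B S v))"
proof -
  have fin: "finite S" using assms(1) by (rule colouring_finite)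
  have "S \<subseteq> insert v (nbrs R S v \<union> nbrs B S v)"
    using assms by (auto simp: colouring_def nbrs_def)
  then have "card S \<le> card (insert v (nbrs R S v \<union> nbrs B S v))"
    using fin by (intro card_mono) (auto simp: finite_nbrs)
  also have "\<dots> \<le> Suc (card (nbrs R S v \<union> nbrs B S v))" by (rule card_insert_le_m1) auto
  also have "\<dots> \<le> Suc (card (nbrs R S v) + card (nbrs B S v))" using card_Un_le by auto
  finally show ?thesis .
qed

lemma even_card_perfect_matching:
  assumes "finite S" "symp B" "irreflp B" "\<And>v. v \<in> S \<Longrightarrow> card (nbrs B S v) = 1"
  shows "even (card S)"
  using assms
proof (induction "card S" arbitrary: S rule: less_induct)
  case less
  show ?case
  proof (cases "S = {}")
    case False
    then obtain x where x: "x \<in> S" by blast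
    then obtain y where y: "nbrs B S x = {y}" using less.prems(4) card_1_singletonE by blast
    then have yS: "y \<in> S" and xy: "B x y" "B y x" and ne: "x \<noteq> y"
      using less.prems(2,3) by (auto simp: nbrs_def symp_def irreflp_def)
    then have "x \<in> nbrs B S y" using x by (simp add: nbrs_def)
    moreover obtain z where "nbrs B S y = {z}" using less.prems(4)[OF yS] card_1_singletonE by blast
    ultimately have y': "nbrs B S y = {x}" by auto
    have "nbrs B (S - {x, y}) v = nbrs B S v" if v: "v \<in> S - {x, y}" for v
    proof -
      have "\<not> B x v" "\<not> B y v" using v y y' by (auto simp: nbrs_def)
      then have "\<not> B v x" "\<not> B v y" using less.prems(2) by (auto simp: symp_def)
      then show ?thesis by (auto simp: nbrs_def)
    qed
    moreover have c: "card S = Suc (Suc (card (S - {x, y})))"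
      using less.prems(1) x yS ne card_Diff_subset[of "{x, y}" S] card_mono[of S "{x, y}"] by simp
    ultimately have "even (card (S - {x, y}))"
      using less.prems by (intro less.hyps) auto
    then show ?thesis using c by simp
  qed simp
qed

text \<open>Without a blue \<open>T 3\<close> every vertex misses at most one other vertex in red, so any vertex can
  serve as the dominating vertex of \<open>T (n - 1)\<close>, where \<open>n\<close> is the number of vertices. Its
  red neighbourhood has at least \<open>n - 2\<close> vertices and again no blue \<open>T 3\<close>, so by induction it
  contains \<open>T (n - 3)\<close>.\<close>

lemma matching_complement_threshold:
  assumes "colouring S R B" "\<not> has_threshold B S 3"
  shows "has_threshold R S (card S - 1)"
  using assms
proof (induction "card S" arbitrary: S rule: less_induct)
  case less
  have fin: "finite S" using less.prems(1) by (rule colouring_finite)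
  show ?case
  proof (cases "card S < 3")
    case True
    then have "card S - 1 = 0 \<or> card S - 1 = Suc 0" by auto
    then show ?thesis by auto
  next
    case False
    then obtain v where v: "v \<in> S" by fastforce
    let ?N = "nbrs R S v"
    have "card (nbrs B S v) < 2" using less.prems(2) v by (auto simp: has_threshold_3)
    then have d: "card S \<le> Suc (Suc (card ?N))" using degree_sum[OF less.prems(1) v] by simp
    have "v \<notin> ?N" using less.prems(1) by (auto simp: nbrs_def colouring_def irreflp_def)
    then have "?N \<subset> S" using v nbrs_subset[of R S v] by blast
    then have "card ?N < card S" using fin by (rule psubset_card_mono[rotated])
    moreover have "\<not> has_threshold B ?N 3"
      using less.prems(2) has_threshold_mono[OF _ order_refl nbrs_subset fin] by blast
    ultimately have "has_threshold R ?N (card ?N - 1)"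
      using less.prems(1) by (intro less.hyps colouring_nbrs)
    then have "has_threshold R ?N (card S - 1 - 2)"
      by (rule has_threshold_mono) (use d fin in \<open>auto simp: finite_nbrs\<close>)
    then show ?thesis using v d by - (rule has_threshold_intro[of v], auto)
  qed
qed

text \<open>A matching on an odd number of vertices leaves some vertex unmatched; using that one as
  the dominating vertex gains one more.\<close>

lemma matching_complement_threshold_odd:
  assumes col: "colouring S R B" and B: "\<not> has_threshold B S 3" and odd: "odd (card S)"
  shows "has_threshold R S (card S)"
proof -
  have fin: "finite S" using col by (rule colouring_finite)
  have "\<not> (\<forall>v\<in>S. card (nbrs B S v) = 1)"
    using even_card_perfect_matching[of S B] col odd by (auto simp: colouring_def)
  then obtain v where v: "v \<in> S" "card (nbrs B S v) \<noteq> 1" by blast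
  moreover have "card (nbrs B S v) < 2" using B v by (auto simp: has_threshold_3)
  ultimately have "card (nbrs B S v) = 0" by simp
  then have d: "card S \<le> Suc (card (nbrs R S v))" using degree_sum[OF col v(1)] by simp
  have "\<not> has_threshold B (nbrs R S v) 3"
    using B has_threshold_mono[OF _ order_refl nbrs_subset fin] by blast
  then have "has_threshold R (nbrs R S v) (card (nbrs R S v) - 1)"
    by (rule matching_complement_threshold[OF colouring_nbrs[OF col]])
  then have "has_threshold R (nbrs R S v) (card S - 2)"
    by (rule has_threshold_mono) (use d fin in \<open>auto simp: finite_nbrs\<close>)
  then show ?thesis using v(1) d by - (rule has_threshold_intro[of v], auto)
qed

text \<open>A red edge between red neighbours of \<open>v\<close> is a red triangle, and a third neighbour of \<open>v\<close>
  supplies the pendant edge of \<open>T 4\<close>.\<close>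

lemma red_nbrs_blue_clique:
  assumes col: "colouring S R B" and R: "\<not> has_threshold R S 4" and v: "v \<in> S"
    and deg: "3 \<le> card (nbrs R S v)"
    and xy: "x \<in> nbrs R S v" "y \<in> nbrs R S v" "x \<noteq> y"
  shows "B x y"
proof (rule ccontr)
  assume "\<not> B x y"
  then have "R x y" using col xy by (auto simp: colouring_def nbrs_def)
  then have "has_threshold R (nbrs R S v) 2"
    using xy finite_nbrs[OF colouring_finite[OF col]] by (auto simp: has_threshold_2)
  then have "has_threshold R S 4" using deg v by - (rule has_threshold_intro[of v], auto)
  with R show False by simp
qed

lemma red_degree_less:
  assumes col: "colouring S R B" and R: "\<not> has_threshold R S 4" and v: "v \<in> S"
    and m: "4 \<le> m" and B: "\<not> has_threshold B S m"
  shows "card (nbrs R S v) < m"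
proof (rule ccontr)
  assume "\<not> ?thesis"
  then have d: "m \<le> card (nbrs R S v)" by simp
  note fin = colouring_finite[OF col]
  have "3 \<le> card (nbrs R S v)" using d m by simp
  from clique_has_threshold[OF finite_nbrs[OF fin] d red_nbrs_blue_clique[OF col R v this]]
  have "has_threshold B (nbrs R S v) m" .
  then have "has_threshold B S m" by (rule has_threshold_mono) (auto simp: nbrs_subset fin)
  with B show False by simp
qed

lemma no_threshold_in_large_nbrs:
  assumes "v \<in> S" "\<not> has_threshold B S m" "m \<le> Suc (card (nbrs B S v))"
  shows "\<not> has_threshold B (nbrs B S v) (m - 2)"
  using assms(2) has_threshold_intro[OF assms(1,3)] by blast

text \<open>The red neighbourhood of any vertex is a blue clique on at least \<open>m - 1\<close> vertices. Each of
  its members sees at least \<open>m - 2\<close> others in blue, which contain a \<open>T (m - 2)\<close>, and its blue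
  degree suffices for it to dominate a \<open>T m\<close>.\<close>

lemma blue_threshold_via_clique:
  assumes col: "colouring S R B" and R: "\<not> has_threshold R S 4" and m: "4 \<le> m"
    and S: "S \<noteq> {}"
    and red: "\<And>v. v \<in> S \<Longrightarrow> m - 1 \<le> card (nbrs R S v)"
    and blue: "\<And>v. v \<in> S \<Longrightarrow> m - 1 \<le> card (nbrs B S v)"
  shows "has_threshold B S m"
proof -
  note fin = colouring_finite[OF col]
  obtain v where v: "v \<in> S" using S by blast
  let ?N = "nbrs R S v"
  have "3 \<le> card ?N" using red[OF v] m by simp
  note clique = red_nbrs_blue_clique[OF col R v this]
  have "?N \<noteq> {}" using red[OF v] m by auto
  then obtain a where a: "a \<in> ?N" by blast
  then have aS: "a \<in> S" using nbrs_subset by fastforce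
  have sub: "?N - {a} \<subseteq> nbrs B S a" using clique a by (auto simp: nbrs_def)
  have "has_threshold B (?N - {a}) (m - 2)"
    using red[OF v] a clique by (intro clique_has_threshold) (auto simp: finite_nbrs fin)
  then have "has_threshold B (nbrs B S a) (m - 2)"
    by (rule has_threshold_mono[OF _ order_refl sub finite_nbrs[OF fin]])
  then show ?thesis using blue[OF aS] aS by - (rule has_threshold_intro[of a], auto)
qed

text \<open>If there is no blue \<open>T 4\<close> either, all degrees are at most 3 by \<open>red_degree_less\<close>; on 7 or more vertices they
  must then all be exactly 3.\<close>

lemma ramsey_4_4:
  assumes col: "colouring S R B" and R: "\<not> has_threshold R S 4" and n: "7 \<le> card S"
  shows "has_threshold B S 4"
proof (rule ccontr)
  assume B: "\<not> ?thesis"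
  have r: "card (nbrs R S v) < 4" if "v \<in> S" for v
    by (rule red_degree_less[OF col R that _ B]) simp
  have b: "card (nbrs B S v) < 4" if "v \<in> S" for v
    by (rule red_degree_less[OF colouring_swap[OF col] B that _ R]) simp
  have "card (nbrs R S v) = 3 \<and> card (nbrs B S v) = 3" if "v \<in> S" for v
    using r[OF that] b[OF that] degree_sum[OF col that] n by linarith
  moreover have "S \<noteq> {}" using n by auto
  ultimately have "has_threshold B S 4" by (intro blue_threshold_via_clique[OF col R]) auto
  with B show False by simp
qed

text \<open>If there is no blue \<open>T 5\<close>, red degrees are at most 4 by \<open>red_degree_less\<close>. Blue degrees are at most 4 as well: a blue
  neighbourhood contains no blue \<open>T 3\<close>, so with 5 or more vertices it would contain a red
  \<open>T 4\<close> as the complement of a matching. On 9 or more vertices all degrees are thus 4.\<close>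

lemma ramsey_4_5:
  assumes col: "colouring S R B" and R: "\<not> has_threshold R S 4" and n: "9 \<le> card S"
  shows "has_threshold B S 5"
proof (rule ccontr)
  assume B: "\<not> ?thesis"
  note fin = colouring_finite[OF col]
  have d: "card (nbrs R S v) = 4 \<and> card (nbrs B S v) = 4" if v: "v \<in> S" for v
  proof -
    have r: "card (nbrs R S v) < 5" by (rule red_degree_less[OF col R v _ B]) simp
    then have "5 \<le> Suc (card (nbrs B S v))" using degree_sum[OF col v] n by linarith
    then have "\<not> has_threshold B (nbrs B S v) 3"
      using no_threshold_in_large_nbrs[OF v B] by simp
    from matching_complement_threshold[OF colouring_nbrs[OF col] this]
    have t: "has_threshold R (nbrs B S v) (card (nbrs B S v) - 1)" .
    have "card (nbrs B S v) < 5"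
    proof (rule ccontr)
      assume "\<not> ?thesis"
      then have "has_threshold R S 4"
        by (intro has_threshold_mono[OF t _ nbrs_subset fin]) simp
      with R show False by simp
    qed
    then show ?thesis using r degree_sum[OF col v] n by linarith
  qed
  moreover have "S \<noteq> {}" using n by auto
  ultimately have "has_threshold B S 5" by (intro blue_threshold_via_clique[OF col R]) auto
  with B show False by simp
qed

text \<open>If there is no blue \<open>T 6\<close>, a blue neighbourhood contains neither a blue nor a red \<open>T 4\<close>, so
  it has at most 6 vertices by \<open>ramsey_4_4\<close>. Hence red degrees are at least 4, and there is a blue
  clique \<open>K\<close> on 4 vertices inside some red neighbourhood. A vertex outside \<open>K\<close> has at most one
  blue neighbour in \<open>K\<close>, since a second one would complete a \<open>T 6\<close>. So any two vertices outside
  \<open>K\<close> have a common red neighbour in \<open>K\<close> and are joined in blue: everything outside \<open>K\<close> is a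
  blue clique, on at least 7 vertices.\<close>

lemma ramsey_4_6:
  assumes col: "colouring S R B" and R: "\<not> has_threshold R S 4" and n: "11 \<le> card S"
  shows "has_threshold B S 6"
proof (rule ccontr)
  assume B: "\<not> ?thesis"
  note fin = colouring_finite[OF col]
  have sym: "B y x" if "B x y" for x y using col that by (auto simp: colouring_def symp_def)
  have rsym: "R y x" if "R x y" for x y using col that by (auto simp: colouring_def symp_def)
  have blue: "5 \<le> card (nbrs B S v)" if v: "v \<in> S" for v
    using red_degree_less[OF col R v _ B] degree_sum[OF col v] n by simp
  have noB4: "\<not> has_threshold B (nbrs B S v) 4" if v: "v \<in> S" for v
    using no_threshold_in_large_nbrs[OF v B] blue[OF v] by simp
  have red: "4 \<le> card (nbrs R S v)" if v: "v \<in> S" for v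
  proof -
    have "\<not> has_threshold R (nbrs B S v) 4"
      using R has_threshold_mono[OF _ order_refl nbrs_subset fin] by blast
    then have "card (nbrs B S v) < 7"
      using ramsey_4_4[OF colouring_nbrs[OF col]] noB4[OF v] by (meson not_less)
    then show ?thesis using degree_sum[OF col v] n by linarith
  qed
  have clique: "B x y" if "v \<in> S" "x \<in> nbrs R S v" "y \<in> nbrs R S v" "x \<noteq> y" for v x y
    using red_nbrs_blue_clique[OF col R that(1) _ that(2-4)] red[OF that(1)] by simp
  have "S \<noteq> {}" using n by auto
  then obtain v where v: "v \<in> S" by blast
  obtain K where K: "K \<subseteq> nbrs R S v" "card K = 4" "finite K"
    using obtain_subset_with_card_n[OF red[OF v]] by metis
  have KS: "K \<subseteq> S" using K(1) nbrs_subset by fast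
  have KB: "B x y" if "x \<in> K" "y \<in> K" "x \<noteq> y" for x y using clique[OF v] K(1) that by blast
  have one: "a = b" if w: "w \<in> S - K" and ab: "a \<in> K" "b \<in> K" "B w a" "B w b" for w a b
  proof (rule ccontr)
    assume ne: "a \<noteq> b"
    have aS: "a \<in> S" and bS: "b \<in> S" using ab KS by auto
    let ?A = "nbrs B S a"
    have card2: "card (K - {a, b}) = 2" using K ab ne by (simp add: card_Diff_subset)
    then obtain c d where cd: "K - {a, b} = {c, d}" "c \<noteq> d" by (meson card_2_iff)
    have sub: "insert w (K - {a, b}) \<subseteq> nbrs B ?A b"
      using w ab KB sym KS by (auto simp: nbrs_def)
    have "card (insert w (K - {a, b})) = 3" using card2 w K(3) by simp
    then have "3 \<le> card (nbrs B ?A b)"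
      using card_mono[OF _ sub] fin by (simp add: finite_nbrs)
    moreover have "c \<in> K - {a, b}" "d \<in> K - {a, b}" using cd(1) by simp_all
    then have "c \<in> nbrs B ?A b" "d \<in> nbrs B ?A b" "B c d"
      using sub KB[OF _ _ cd(2)] by (simp_all add: subset_iff)
    then have "has_threshold B (nbrs B ?A b) 2" using fin by (auto simp: has_threshold_2 finite_nbrs)
    moreover have "b \<in> ?A" using bS KB[OF ab(1,2) ne] by (simp add: nbrs_def)
    ultimately have "has_threshold B ?A 4" by - (rule has_threshold_intro[of b], auto)
    with noB4[OF aS] show False by simp
  qed
  have "B x y" if xy: "x \<in> S - K" "y \<in> S - K" "x \<noteq> y" for x y
  proof -
    have le: "card (nbrs B K w) \<le> 1" if "w \<in> S - K" for w
      using one[OF that] by (auto simp: nbrs_def intro!: card_le_Suc0_iff_eq[THEN iffD2] K(3))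
    have "card (nbrs B K x \<union> nbrs B K y) \<le> 2"
      using card_Un_le[of "nbrs B K x" "nbrs B K y"] le[OF xy(1)] le[OF xy(2)] by linarith
    then have "card (nbrs B K x \<union> nbrs B K y) < card K" using K(2) by simp
    then have "\<not> K \<subseteq> nbrs B K x \<union> nbrs B K y"
      using K(3) by (meson card_mono finite_UnI finite_nbrs not_less)
    then obtain z where z: "z \<in> K" "\<not> B x z" "\<not> B y z" by (auto simp: nbrs_def)
    moreover have "x \<in> S" "y \<in> S" "z \<in> S" "x \<noteq> z" "y \<noteq> z" using z(1) xy KS by auto
    ultimately have "R x z" "R y z" using col unfolding colouring_def by blast+
    then show ?thesis using clique[of z x y] z KS xy rsym by (auto simp: nbrs_def)
  qed
  moreover have "6 \<le> card (S - K)" using K n KS by (simp add: card_Diff_subset)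
  ultimately have "has_threshold B (S - K) 6" using fin by (intro clique_has_threshold) auto
  then have "has_threshold B S 6" by (rule has_threshold_mono) (auto simp: fin)
  with B show False by simp
qed

text \<open>A red \<open>T 3\<close> among the red neighbours of \<open>v\<close> extends to a red \<open>T 5\<close> dominated by \<open>v\<close>.
  Otherwise the red edges between any 5 red neighbours form a matching, and since 5 is odd the
  blue edges contain \<open>T 5\<close>.\<close>

lemma threshold_5_of_degree_5:
  assumes col: "colouring S R B" and v: "v \<in> S" and deg: "5 \<le> card (nbrs R S v)"
  shows "has_threshold R S 5 \<or> has_threshold B S 5"
proof (cases "has_threshold R (nbrs R S v) 3")
  case True
  then show ?thesis using v deg by - (rule disjI1, rule has_threshold_intro[of v], auto)
next
  case False
  note fin = colouring_finite[OF col]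
  obtain T where T: "T \<subseteq> nbrs R S v" "card T = 5"
    using obtain_subset_with_card_n[OF deg] by metis
  then have TS: "T \<subseteq> S" using nbrs_subset by fast
  have "\<not> has_threshold R T 3"
    using False has_threshold_mono[OF _ order_refl T(1)] finite_nbrs[OF fin] by blast
  then have "has_threshold B T 5"
    using matching_complement_threshold_odd[OF colouring_swap[OF colouring_subset[OF col TS]]] T(2)
    by simp
  then show ?thesis using has_threshold_mono[OF _ order_refl TS fin] by blast
qed

lemma ramsey_5_5:
  assumes col: "colouring S R B" and n: "10 \<le> card S"
  shows "has_threshold R S 5 \<or> has_threshold B S 5"
proof -
  have "S \<noteq> {}" using n by auto
  then obtain v where v: "v \<in> S" by blast
  have "5 \<le> card (nbrs R S v) \<or> 5 \<le> card (nbrs B S v)"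
    using degree_sum[OF col v] n by linarith
  then show ?thesis
    using threshold_5_of_degree_5[OF col v] threshold_5_of_degree_5[OF colouring_swap[OF col] v]
    by blast
qed

lemma threshold_pair:
  assumes col: "colouring S R B" and n: "3 \<le> card S" "card S \<le> 12"
    and R: "has_threshold R S 2" and B: "has_threshold B S 2"
  shows "\<exists>a b. has_threshold R S a \<and> has_threshold B S b \<and> a + b = (card S + 1) div 2 + 3"
proof -
  define r where "r = (card S + 1) div 2"
  note fin = colouring_finite[OF col]
  have r: "2 \<le> r" "r \<le> 6" "2 * r \<le> Suc (card S)" using n by (auto simp: r_def)
  have weaken: "has_threshold Q S j" if "has_threshold Q S k" "j \<le> k" for Q j k
    by (rule has_threshold_mono[OF that order_refl fin])
  have sparse: "has_threshold P S (r + 1)" if "colouring S P Q" "\<not> has_threshold Q S 3" for P Q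
  proof (cases "card S = 3")
    case True
    then show ?thesis using matching_complement_threshold_odd[OF that] by (simp add: r_def)
  next
    case False
    then have "r + 1 \<le> card S - 1" using n by (auto simp: r_def)
    then show ?thesis by (rule weaken[OF matching_complement_threshold[OF that]])
  qed
  consider "\<not> has_threshold B S 3" | "\<not> has_threshold R S 3"
    | "has_threshold R S 3" "has_threshold B S 3" by blast
  then have "\<exists>a b. has_threshold R S a \<and> has_threshold B S b \<and> r + 3 \<le> a + b"
  proof cases
    case 1
    then show ?thesis using sparse[OF col] B by (intro exI[of _ "r + 1"] exI[of _ 2]) auto
  next
    case 2
    then show ?thesis
      using sparse[OF colouring_swap[OF col]] R by (intro exI[of _ 2] exI[of _ "r + 1"]) auto
  next
    case 3
    have dense: "\<exists>k. has_threshold Q S k \<and> r \<le> k"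
      if "colouring S P Q" "\<not> has_threshold P S 4" "has_threshold Q S 3" for P Q
    proof -
      consider "r \<le> 3" | "r = 4" | "r = 5" | "r = 6" using r by linarith
      then show ?thesis
      proof cases
        case 1 then show ?thesis using that(3) by blast
      next
        case 2 then show ?thesis using ramsey_4_4[OF that(1,2)] r(3) by fastforce
      next
        case 3 then show ?thesis using ramsey_4_5[OF that(1,2)] r(3) by fastforce
      next
        case 4 then show ?thesis using ramsey_4_6[OF that(1,2)] r(3) by fastforce
      qed
    qed
    consider "\<not> has_threshold R S 4" | "\<not> has_threshold B S 4"
      | "has_threshold R S 4" "has_threshold B S 4" by blast
    then show ?thesis
    proof cases
      case 1
      from dense[OF col this 3(2)] 3(1) show ?thesis by (metis add.commute add_mono order_refl)
    next
      case 2
      from dense[OF colouring_swap[OF col] this 3(1)] 3(2) show ?thesis by (metis add_mono order_refl)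
    next
      case 44: 3
      show ?thesis
      proof (cases "r = 6")
        case True
        then have "has_threshold R S 5 \<or> has_threshold B S 5" using ramsey_5_5[OF col] r(3) by simp
        then show ?thesis
        proof
          assume "has_threshold R S 5"
          then show ?thesis using 44 r by (intro exI[of _ 5] exI[of _ 4]) auto
        next
          assume "has_threshold B S 5"
          then show ?thesis using 44 r by (intro exI[of _ 4] exI[of _ 5]) auto
        qed
      next
        case False
        then show ?thesis using 44 r by (intro exI[of _ 4]) auto
      qed
    qed
  qed
  then obtain a b where ab: "has_threshold R S a" "has_threshold B S b" "r + 3 \<le> a + b" by blast
  \<comment> \<open>Containment is monotone in the size, so an excess in \<open>a + b\<close> can be cut down.\<close>
  have "has_threshold R S (min a (r + 3))" "has_threshold B S (r + 3 - min a (r + 3))"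
    using ab by (auto intro: weaken)
  moreover have "min a (r + 3) + (r + 3 - min a (r + 3)) = (card S + 1) div 2 + 3"
    by (simp add: r_def)
  ultimately show ?thesis by blast
qed

section \<open>The upper bound\<close>

lemma strength_sum_upper:
  assumes G: "simple_graph V E" and ne: "E \<noteq> {}" "complement_edges V E \<noteq> {}"
    and n: "3 \<le> card V" "card V \<le> 12"
  shows "strength V E + strength V (complement_edges V E) + (card V + 1) div 2 + 3 \<le> 4 * card V"
proof -
  let ?C = "complement_edges V E"
  define R where "R = (\<lambda>u v. {u, v} \<in> E)"
  define B where "B = (\<lambda>u v. {u, v} \<in> ?C)"
  note Gc = simple_graph_complement[OF G]
  have fin: "finite V" using G by (simp add: simple_graph_def)
  have irr: "\<not> R v v" "\<not> B v v" for v using G Gc by (auto simp: R_def B_def simple_graph_def)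
  have "R u v \<or> B u v" if "u \<in> V" "v \<in> V" "u \<noteq> v" for u v
    using that by (auto simp: R_def B_def complement_edges_def)
  then have col: "colouring V R B"
    using fin irr by (auto simp: colouring_def symp_def irreflp_def R_def B_def insert_commute)
  have edge: "\<exists>u\<in>V. \<exists>v\<in>V. {u, v} \<in> F" if F: "simple_graph V F" "F \<noteq> {}" for F
  proof -
    obtain e where "e \<in> F" using F(2) by blast
    moreover from this obtain u v where "e = {u, v}"
      using F(1) by (auto simp: simple_graph_def card_2_iff)
    moreover from calculation have "u \<in> V" "v \<in> V" using F(1) by (auto simp: simple_graph_def)
    ultimately show ?thesis by blast
  qed
  have "has_threshold R V 2" "has_threshold B V 2"
    using edge[OF G ne(1)] edge[OF Gc ne(2)] fin by (auto simp: has_threshold_2 R_def B_def)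
  from threshold_pair[OF col n this] obtain a b where ab: "has_threshold R V a" "has_threshold B V b"
    "a + b = (card V + 1) div 2 + 3" by blast
  have "strength V E \<le> 2 * card V - b"
    by (rule strength_le_threshold[OF G ne(1) ab(2) irr(2)]) (simp add: B_def complement_edges_def)
  moreover have "strength V ?C \<le> 2 * card V - a"
    by (rule strength_le_threshold[OF Gc ne(2) ab(1) irr(1)]) (simp add: R_def complement_edges_def)
  moreover have "a + b \<le> 2 * card V" using ab(3) n by linarith
  ultimately show ?thesis using ab(3) by linarith
qed

section \<open>The lower bound\<close>

lemma strength_geI:
  assumes G: "simple_graph V E" "E \<noteq> {}"
    and g: "\<And>g. numbering V g \<Longrightarrow> \<exists>u v. {u, v} \<in> E \<and> s \<le> g u + g v"
  shows "s \<le> strength V E"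
proof -
  have fin: "finite V" using G by (simp add: simple_graph_def)
  have ge: "s \<le> numbering_strength E g" if num: "numbering V g" for g
  proof -
    let ?S = "{g u + g v | u v. {u, v} \<in> E}"
    have "?S \<subseteq> (\<lambda>(u, v). g u + g v) ` (V \<times> V)" using G(1) by (fastforce simp: simple_graph_def)
    then have "finite ?S" by (rule finite_subset) (simp add: fin)
    moreover obtain u v where uv: "{u, v} \<in> E" "s \<le> g u + g v" using g[OF num] by blast
    ultimately have "g u + g v \<le> numbering_strength E g"
      unfolding numbering_strength_def by (intro Max_ge) auto
    then show ?thesis using uv(2) by simp
  qed
  obtain g where "numbering V g" using ex_numbering[OF fin] by blast
  then show ?thesis
    unfolding strength_def using finite_numbering_strengths[OF G] ge by (intro Min.boundedI) auto
qed

text \<open>The neighbours of the vertex labelled \<open>n\<close> carry at least \<open>d\<close> different positive labels, one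
  of which is at least \<open>d\<close>.\<close>

lemma strength_ge_min_degree:
  assumes G: "simple_graph V E" "E \<noteq> {}"
    and d: "0 < d" and deg: "\<And>v. v \<in> V \<Longrightarrow> d \<le> card {u. {v, u} \<in> E}"
  shows "card V + d \<le> strength V E"
proof (rule strength_geI[OF G])
  fix g assume g: "numbering V g"
  have "V \<noteq> {}" using G by (fastforce simp: simple_graph_def)
  moreover have fin: "finite V" using G by (simp add: simple_graph_def)
  ultimately have "card V \<in> {1..card V}" by (simp add: Suc_le_eq card_gt_0_iff)
  then obtain v where v: "v \<in> V" "g v = card V"
    using g unfolding numbering_def bij_betw_def by (metis imageE)
  let ?N = "{u. {v, u} \<in> E}"
  have NV: "?N \<subseteq> V" using G(1) by (auto simp: simple_graph_def)
  have "\<exists>u\<in>?N. d \<le> g u"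
  proof (rule ccontr)
    assume "\<not> ?thesis"
    moreover have "1 \<le> g u" if "u \<in> V" for u
      using g that by (auto simp: numbering_def bij_betw_def)
    ultimately have "g ` ?N \<subseteq> {1..<d}" using NV by force
    then have "card (g ` ?N) \<le> d - 1" using card_mono[of "{1..<d}"] by simp
    moreover have "inj_on g ?N"
      using g NV by (auto simp: numbering_def bij_betw_def intro: inj_on_subset)
    ultimately show False using deg[OF v(1)] d by (simp add: card_image)
  qed
  then show "\<exists>u v. {u, v} \<in> E \<and> card V + d \<le> g u + g v" using v(2) by force
qed

text \<open>Some two of the vertices labelled \<open>n\<close>, \<open>n - 1\<close>, \<open>n - 2\<close> are adjacent.\<close>

lemma strength_ge_no_independent_triple:
  assumes G: "simple_graph V E" "E \<noteq> {}" and n: "3 \<le> card V"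
    and triple: "\<And>x y z. x \<in> V \<Longrightarrow> y \<in> V \<Longrightarrow> z \<in> V \<Longrightarrow> x \<noteq> y \<Longrightarrow> x \<noteq> z \<Longrightarrow> y \<noteq> z \<Longrightarrow>
      {x, y} \<in> E \<or> {x, z} \<in> E \<or> {y, z} \<in> E"
  shows "2 * card V - 3 \<le> strength V E"
proof (rule strength_geI[OF G])
  fix g assume g: "numbering V g"
  have lab: "\<exists>v\<in>V. g v = i" if "1 \<le> i" "i \<le> card V" for i
    using g that unfolding numbering_def bij_betw_def by (metis atLeastAtMost_iff imageE)
  obtain x where x: "x \<in> V" "g x = card V" using lab[of "card V"] n by auto
  obtain y where y: "y \<in> V" "g y = card V - 1" using lab[of "card V - 1"] n by fastforce
  obtain z where z: "z \<in> V" "g z = card V - 2" using lab[of "card V - 2"] n by fastforce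
  have "x \<noteq> y" "x \<noteq> z" "y \<noteq> z" using x y z n by auto
  from triple[OF x(1) y(1) z(1) this]
  show "\<exists>u v. {u, v} \<in> E \<and> 2 * card V - 3 \<le> g u + g v"
  proof (elim disjE)
    assume "{x, y} \<in> E" then show ?thesis using x y n by (intro exI[of _ x] exI[of _ y]) auto
  next
    assume "{x, z} \<in> E" then show ?thesis using x z n by (intro exI[of _ x] exI[of _ z]) auto
  next
    assume "{y, z} \<in> E" then show ?thesis using y z n by (intro exI[of _ y] exI[of _ z]) auto
  qed
qed

lemma max_strength_sum_lower:
  assumes n: "3 \<le> n"
  shows "4 * n - (n + 1) div 2 - 3 \<le> max_strength_sum n"
proof -
  define h where "h = n div 2"
  define V where "V = {..<n}"
  define E where "E = {{a, b} | a b. a < h \<and> h \<le> b \<and> b < n}"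
  let ?C = "complement_edges V E"
  have h: "0 < h" "h < n" "h \<le> n - h" using n by (auto simp: h_def)
  have cV: "card V = n" by (simp add: V_def)
  have E_iff: "{a, b} \<in> E \<longleftrightarrow> a < h \<and> h \<le> b \<and> b < n \<or> b < h \<and> h \<le> a \<and> a < n" for a b
    by (auto simp: E_def doubleton_eq_iff)
  have G: "simple_graph V E" using h by (auto simp: simple_graph_def V_def E_def card_2_iff) force
  have C_iff: "{a, b} \<in> ?C \<longleftrightarrow> a \<in> V \<and> b \<in> V \<and> a \<noteq> b \<and> (a < h \<longleftrightarrow> b < h)" for a b
    using h by (auto simp: complement_edges_def E_iff V_def card_insert_if)
  have "{0, h} \<in> E" using h by (simp add: E_iff)
  then have neE: "E \<noteq> {}" by blast
  have "{n - 1, n - 2} \<in> ?C" unfolding C_iff using n by (auto simp: V_def h_def)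
  then have neC: "?C \<noteq> {}" by blast
  have "h \<le> card {u. {v, u} \<in> E}" if v: "v \<in> V" for v
  proof (cases "v < h")
    case True
    then have "{u. {v, u} \<in> E} = {h..<n}" by (auto simp: E_iff)
    then show ?thesis using h by simp
  next
    case False
    then have "{u. {v, u} \<in> E} = {..<h}" using v by (auto simp: E_iff V_def)
    then show ?thesis by simp
  qed
  from strength_ge_min_degree[OF G neE h(1) this] have "n + h \<le> strength V E" by (simp add: cV)
  moreover have "2 * card V - 3 \<le> strength V ?C"
    by (rule strength_ge_no_independent_triple[OF simple_graph_complement[OF G] neC])
      (use n in \<open>auto simp: C_iff cV\<close>)
  moreover have "strength V E + strength V ?C \<le> max_strength_sum n"
    using strength_sum_le[OF G neE neC] by (simp add: cV)
  ultimately show ?thesis using n unfolding cV h_def by linarith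
qed

lemma max_strength_sum_eq:
  assumes n: "3 \<le> n" "n \<le> 12"
  shows "max_strength_sum n = 4 * n - (n + 1) div 2 - 3"
proof (rule antisym)
  let ?S = "{strength V E + strength V (complement_edges V E) | (V :: nat set) E.
    simple_graph V E \<and> card V = n \<and> E \<noteq> {} \<and> complement_edges V E \<noteq> {}}"
  have le: "x \<le> 4 * n - (n + 1) div 2 - 3" if "x \<in> ?S" for x
    using that n strength_sum_upper by fastforce
  then have "?S \<subseteq> {..4 * n - (n + 1) div 2 - 3}" by blast
  then have "finite ?S" by (rule finite_subset) simp
  moreover have "?S \<noteq> {}"
  proof -
    have "simple_graph {..<n} {{0, 1}}" using n by (auto simp: simple_graph_def)
    moreover have "{0, 2} \<in> complement_edges {..<n} {{0, 1}}"
      using n by (auto simp: complement_edges_def doubleton_eq_iff)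
    ultimately show ?thesis by force
  qed
  ultimately show "max_strength_sum n \<le> 4 * n - (n + 1) div 2 - 3"
    unfolding max_strength_sum_def using le by (intro Max.boundedI)
qed (rule max_strength_sum_lower[OF n(1)])

theorem mainTheorem5:
  shows "max_strength_sum 3 = 7 \<and> max_strength_sum 4 = 11 \<and> max_strength_sum 5 = 14 \<and>
    max_strength_sum 6 = 18 \<and> max_strength_sum 7 = 21 \<and> max_strength_sum 8 = 25 \<and>
    max_strength_sum 9 = 28 \<and> max_strength_sum 10 = 32 \<and> max_strength_sum 11 = 35 \<and>
    max_strength_sum 12 = 39"
  by (simp add: max_strength_sum_eq)

end
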